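(* Let $n,m,q,L,N\in\mathbb{N}$ and consider the noisy LTV system $$x(k+1)=A(k)x(k)+B(k)u(k)+d(k),\qquad \zeta(k)=x(k)+v(k),$$ with $A(k)\in\mathbb{R}^{n\times n}$, $B(k)\in\mathbb{R}^{n\times m}$. Let $Z(k)\in\mathbb{R}^{n\times L}$, $k=0,\dots,N$, and $U(k)\in\mathbb{R}^{m\times L}$, $k=0,\dots,N-1$, be the data matrices formed from an ensemble of $L$ input-output data sequences of this system, with associated noise matrices $V(k)$, $D(k)$ (see context), and suppose that $$\mathrm{rank}\begin{bmatrix}Z(k)\\ U(k)\end{bmatrix}=n+m,\qquad k=0,\dots,N-1.$$ Suppose that $W(k)=A(k)V(k)-V(k+1)-D(k)\in\mathbb{R}^{n\times L}$ satisfies $$\begin{bmatrix}I_n\\ W(k)^\top\end{bmatrix}^\top\begin{bmatrix}Q_r(k)&S_r(k)\\ S_r(k)^\top&R_r(k)\end{bmatrix}\begin{bmatrix}I_n\\ W(k)^\top\end{bmatrix}\succeq0,\qquad k=0,\dots,N-1,$$ where $Q_r(k)\in\mathbb{R}^{n\times n}$ is symmetric, $S_r(k)\in\mathbb{R}^{n\times L}$, and $R_r(k)\in\mathbb{R}^{L\times L}$ is symmetric with $R_r(k)\prec0$. Let the performance output matrices $C(k),C(N)\in\mathbb{R}^{q\times n}$, $D_u(k)\in\mathbb{R}^{q\times m}$, $D_d(k)\in\mathbb{R}^{q\times n}$ and the performance index $Q_p(k),S_p(k),R_p(k)$ with $\tilde Q_p(k),\tilde S_p(k),\tilde R_p(k)$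 be as in the context. Let $Y(k)\in\mathbb{R}^{L\times n}$, $M(k)\in\mathbb{R}^{L\times m}$, $k=0,\dots,N-1$, and $\mathcal P(k)=\mathcal P(k)^\top\in\mathbb{R}^{n\times n}$, $k=0,\dots,N$, be any sequences of matrices satisfying, for $k=0,\dots,N-1$, $$\begin{bmatrix} \mathcal P(k+1)-Q_r(k)&\star&\star&\star&\star\\ -\tilde S_p(k)^\top\bar E_{cl}(k)^\top&-D_{cl}(k)\tilde S_p(k)-\tilde S_p(k)^\top D_{cl}(k)^\top+\tilde R_p(k)&\star&\star&\star\\ -S_r(k)^\top&-\bar M(k)\tilde S_p(k)&-R_r(k)&\star&\star\\ \bar E_{cl}(k)^\top&D_{cl}(k)^\top&\bar M(k)^\top&-\tilde Q_p(k)^{-1}&\star\\ \big(Z(k+1)Y(k)\big)^\top&\big(C(k)\mathcal P(k)+D_u(k)U(k)Y(k)\big)^\top&Y(k)^\top&0&\mathcal P(k) \end{bmatrix}\succ0,$$ $$Z(k)Y(k)=\mathcal P(k),\qquad \begin{bmatrix}0\\ I_m\end{bmatrix}=\begin{bmatrix}Z(k)\\ U(k)\end{bmatrix}M(k),$$ and $$I_q-C(N)\mathcal P(N)C(N)^\top\succeq0,$$ where $\bar E_{cl}(k)=[\,Z(k+1)M(k)\ \ I_n\,]$, $\bar M(k)=[\,M(k)\ \ 0\,]\in\mathbb{R}^{L\times(m+n)}$ and $D_{cl}(k)=[\,D_u(k)\ \ D_d(k)\,]$. Then, with $$K(k)=U(k)Y(k)\mathcal P(k)^{-1},\qquad k=0,\dots,N-1,$$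 the trajectories of the closed-loop system $$x(k+1)=\big(A(k)+B(k)K(k)\big)x(k)+[\,B(k)\ \ I_n\,]\bar w(k),$$ $$z(k)=\big(C(k)+D_u(k)K(k)\big)x(k)+D_{cl}(k)\bar w(k),\qquad z_f=C(N)x(N),$$ $k=0,\dots,N-1$, with initial condition $x(0)=0$, satisfy the quadratic robust performance criterion: there exists $\varepsilon>0$ such that $$z_f^\top z_f+\sum_{k=0}^{N-1}\begin{bmatrix}\bar w(k)\\ z(k)\end{bmatrix}^\top\begin{bmatrix}Q_p(k)&S_p(k)\\ S_p(k)^\top&R_p(k)\end{bmatrix}\begin{bmatrix}\bar w(k)\\ z(k)\end{bmatrix}+\varepsilon\sum_{k=0}^{N-1}\bar w(k)^\top\bar w(k)\le0\quad\text{for all }\bar w\in\ell_2.$$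
   Context: $\succ,\succeq,\prec$ refer to the (semi)definite ordering of symmetric matrices; $\star$ denotes blocks inferred by symmetry; $\ell_2$ is the space of square-summable sequences. Performance index: for $k=0,\dots,N-1$, $Q_p(k)=Q_p(k)^\top\in\mathbb{R}^{(n+m)\times(n+m)}$, $S_p(k)\in\mathbb{R}^{(n+m)\times q}$, $R_p(k)=R_p(k)^\top\in\mathbb{R}^{q\times q}$, $R_p(k)\succeq0$; the matrix $\begin{bmatrix}Q_p(k)&S_p(k)\\ S_p(k)^\top&R_p(k)\end{bmatrix}$ is invertible, with inverse denoted $\begin{bmatrix}\tilde Q_p(k)&\tilde S_p(k)\\ \tilde S_p(k)^\top&\tilde R_p(k)\end{bmatrix}$, and it is assumed that $\tilde Q_p(k)\prec0$. The closed-loop system arises from performance output $z(k)=C(k)x(k)+D_u(k)u(k)+D_d(k)d(k)$, feedback $u(k)=K(k)\zeta(k)$, and $\bar w(k)=[\,(K(k)v(k))^\top\ \ d(k)^\top\,]^\top\in\mathbb{R}^{m+n}$, which is regarded as an arbitrary disturbance input. Data: for each experiment $j=1,\dots,L$, the input $u_{d,j}(k)$ ($k=0,\dots,N-1$) and the noisy state measurement $\zeta_{d,j}(k)=x_{d,j}(k)+v_{d,j}(k)$ ($k=0,\dots,N$) are recorded, where $x_{d,j}(k+1)=A(k)x_{d,j}(k)+B(k)u_{d,j}(k)+d_{d,j}(k)$; all experiments share the same $A(k),B(k)$ (same time-varying behaviour). The states $x_{d,j}$, measurement noise $v_{d,j}$ and process noise $d_{d,j}$ are not measured. The matrices are $Z(k)=[\zeta_{d,1}(k),\dots,\zeta_{d,L}(k)]$,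 $U(k)=[u_{d,1}(k),\dots,u_{d,L}(k)]$, $X(k)=[x_{d,1}(k),\dots,x_{d,L}(k)]$, $V(k)=[v_{d,1}(k),\dots,v_{d,L}(k)]$, $D(k)=[d_{d,1}(k),\dots,d_{d,L}(k)]$, so that $X(k+1)=A(k)X(k)+B(k)U(k)+D(k)$ and $Z(k)=X(k)+V(k)$. *)

theory Defs
  imports "HOL-Analysis.Analysis"
begin

text \<open>
  Block matrices are indexed by sum types. The function \<open>vcat\<close> stacks the components of two
  vectors; as matrices are vectors of rows, it also stacks two matrices on top of each other.
\<close>

definition vcat :: "'e ^ 'a \<Rightarrow> 'e ^ 'b \<Rightarrow> 'e ^ ('a::finite + 'b::finite)" where
  "vcat A B = (\<chi> i. case i of Inl a \<Rightarrow> A $ a | Inr b \<Rightarrow> B $ b)"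

definition hcat :: "'e ^ 'a ^ 'r \<Rightarrow> 'e ^ 'b ^ 'r \<Rightarrow> 'e ^ ('a::finite + 'b::finite) ^ 'r" where
  "hcat A B = (\<chi> i. vcat (A $ i) (B $ i))"

text \<open>
  The symmetric completion of a lower block row: the matrix with rows
  \<open>[A, star]\<close> and \<open>[B, D]\<close>, where \<open>star\<close> is the transpose of \<open>B\<close>.
\<close>

definition sym_block ::
    "real ^ 'a ^ 'a \<Rightarrow> real ^ 'a ^ 'b \<Rightarrow> real ^ 'b ^ 'b \<Rightarrow>
     real ^ ('a::finite + 'b::finite) ^ ('a + 'b)" where
  "sym_block A B D = vcat (hcat A (transpose B)) (hcat B D)"

definition symmetric_mat :: "real ^ 'n ^ 'n \<Rightarrow> bool" where
  "symmetric_mat A \<longleftrightarrow> transpose A = A"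

definition pos_def :: "real ^ 'n ^ 'n \<Rightarrow> bool" where
  "pos_def A \<longleftrightarrow> symmetric_mat A \<and> (\<forall>x. x \<noteq> 0 \<longrightarrow> x \<bullet> (A *v x) > 0)"

definition pos_semidef :: "real ^ 'n ^ 'n \<Rightarrow> bool" where
  "pos_semidef A \<longleftrightarrow> symmetric_mat A \<and> (\<forall>x. x \<bullet> (A *v x) \<ge> 0)"

definition neg_def :: "real ^ 'n ^ 'n \<Rightarrow> bool" where
  "neg_def A \<longleftrightarrow> pos_def (- A)"

text \<open>The value at time \<open>k\<close> of an ensemble of sequences: column \<open>j\<close> is the \<open>j\<close>-th sequence.\<close>

definition data_matrix :: "('l \<Rightarrow> nat \<Rightarrow> real ^ 'n) \<Rightarrow> nat \<Rightarrow> real ^ 'l ^ 'n" where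
  "data_matrix s k = (\<chi> i j. s j k $ i)"

definition ell2 :: "(nat \<Rightarrow> real ^ 'n) set" where
  "ell2 = {w. summable (\<lambda>k. (norm (w k))\<^sup>2)}"

end

theory Submission
  imports Defs
begin

text \<open>
  The storage function \<open>x \<bullet> (matrix_inv (P k) *v x)\<close> proves the claim: along the closed loop it
  satisfies a strict dissipation inequality whose supply rate is minus the performance index.
  Summed over the horizon from \<open>x 0 = 0\<close>, this bounds the index by minus the final storage, which
  dominates the terminal cost (\<open>terminal_bound\<close>). Strictness at each of the finitely many times
  gives a common margin \<open>\<epsilon>\<close> by compactness (\<open>strict_dissipation\<close>).

  The dissipation inequality has to be extracted from the matrix inequality, which involves
  data but not \<open>A\<close> and \<open>B\<close>. The link is the equation \<open>A Z + B U = Z' + W\<close>, with \<open>Z'\<close> the next data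
  matrix: the unknown system is determined by the data up to the noise term \<open>W\<close>
  (\<open>data_equation\<close>, \<open>closed_loop_from_data\<close>). The bound on \<open>W\<close> is a quadratic inequality in
  \<open>transpose W\<close>, that is, in the transposed closed-loop matrices. It can therefore be exploited
  by inserting \<open>transpose W *v a\<close> as a test vector, but what comes out is a dissipation
  inequality for the adjoint system (\<open>dual_dissipation\<close>), in terms of \<open>P\<close> and of the inverse of the
  index matrix.

  The remaining step passes from this dual inequality to the primal one
  (\<open>primal_dissipation\<close>). It is a form of the dualization lemma, which compares a quadratic form
  on a subspace with the inverse form on the orthogonal complement. The negative definiteness of
  \<open>Qp' k\<close> and of \<open>- P k\<close> fixes the inertia; a suitable choice of the dual vector turns the
  usual dimension count into a single identity.
\<close>

text \<open>
  Below, a transposed matrix is moved across an inner product by \<open>inner_transpose_left\<close> and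
  \<open>inner_transpose_right\<close>. The default rewriting of \<open>transpose A *v x\<close> to \<open>x v* A\<close>
  would hide the pattern that these rules need.
\<close>

declare transpose_matrix_vector [simp del]

section \<open>Block vectors and block matrices\<close>

lemma vcat_mult_vec: "vcat A B *v (x :: real ^ 'c::finite) = vcat (A *v x) (B *v x)"
  by (simp add: vec_eq_iff vcat_def matrix_vector_mult_def split: sum.split)

lemma sum_UNIV_sum_type:
  "(\<Sum>i\<in>(UNIV :: ('a::finite + 'b::finite) set). f i)
     = (\<Sum>i\<in>UNIV. f (Inl i)) + (\<Sum>i\<in>UNIV. f (Inr i))"
  by (simp add: UNIV_Plus_UNIV[symmetric] sum.Plus del: UNIV_Plus_UNIV)

lemma hcat_mult_vec: "hcat A B *v vcat x y = A *v x + B *v (y :: real ^ 'b::finite)"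
  by (simp add: vec_eq_iff vcat_def hcat_def matrix_vector_mult_def sum_UNIV_sum_type)

lemma inner_vcat: "vcat a b \<bullet> vcat c d = a \<bullet> c + b \<bullet> (d :: real ^ 'b::finite)"
  by (simp add: vcat_def inner_vec_def sum_UNIV_sum_type)

lemma vcat_inject: "vcat a b = vcat c d \<longleftrightarrow> a = c \<and> b = d"
  by (auto simp: vec_eq_iff vcat_def split: sum.splits)

lemma vcat_zero: "vcat 0 0 = (0 :: real ^ ('a::finite + 'b::finite))"
  by (simp add: vec_eq_iff vcat_def split: sum.split)

lemma vcat_eq_0_iff: "vcat a b = 0 \<longleftrightarrow> a = 0 \<and> (b :: real ^ 'b::finite) = 0"
  by (metis vcat_zero vcat_inject)

lemma vcat_surj:
  fixes w :: "real ^ ('a::finite + 'b::finite)"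
  obtains a b where "w = vcat a b"
proof
  show "w = vcat (\<chi> i. w $ Inl i) (\<chi> i. w $ Inr i)"
    by (simp add: vec_eq_iff vcat_def split: sum.split)
qed

lemma vcat_mult: "vcat A B ** X = vcat (A ** X) (B ** (X :: real ^ 'c::finite ^ 'k::finite))"
  by (simp add: vec_eq_iff vcat_def matrix_matrix_mult_def split: sum.split)

lemma matrix_add_distrib_right:
  "(A + B) ** X = A ** X + B ** (X :: real ^ 'c::finite ^ 'k::finite)"
  by (simp add: vec_eq_iff matrix_matrix_mult_def sum.distrib distrib_right)

lemma uminus_matrix_vector: "(- A) *v x = - (A *v (x :: real ^ 'n::finite))"
  by (simp add: vec_eq_iff matrix_vector_mult_def sum_negf)

lemma inner_transpose_right: "x \<bullet> (transpose A *v y) = (A *v x) \<bullet> (y :: real ^ 'n::finite)"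
  by (metis dot_lmul_matrix inner_commute transpose_matrix_vector)

lemma inner_transpose_left: "(transpose A *v y) \<bullet> x = y \<bullet> (A *v (x :: real ^ 'n::finite))"
  by (metis inner_commute inner_transpose_right)

lemma symmetric_mat_inner:
  "symmetric_mat A \<Longrightarrow> (A *v x) \<bullet> y = x \<bullet> (A *v (y :: real ^ 'n::finite))"
  by (metis inner_transpose_right symmetric_mat_def)

lemma inner_sym_block:
  "vcat x y \<bullet> (sym_block A B D *v vcat x y)
     = x \<bullet> (A *v x) + 2 * (y \<bullet> (B *v x)) + y \<bullet> (D *v y)"
  by (simp add: sym_block_def vcat_mult_vec hcat_mult_vec inner_vcat inner_add_right
      inner_transpose_right inner_commute)

section \<open>Definite matrices\<close>

lemma pos_def_inner_pos: "pos_def P \<Longrightarrow> x \<noteq> 0 \<Longrightarrow> 0 < x \<bullet> (P *v x)"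
  by (simp add: pos_def_def)

lemma pos_def_inner_nonneg: "pos_def P \<Longrightarrow> 0 \<le> x \<bullet> (P *v x)"
  by (cases "x = 0") (auto simp: pos_def_def less_imp_le)

lemma pos_def_invertible:
  fixes P :: "real ^ 'n::finite ^ 'n"
  assumes "pos_def P"
  shows "invertible P"
proof -
  have "x = 0" if "P *v x = 0" for x
    using pos_def_inner_pos[OF assms, of x] that by auto
  then show ?thesis
    using invertible_left_inverse matrix_left_invertible_ker by blast
qed

lemma neg_def_inner_neg: "neg_def Q \<Longrightarrow> x \<noteq> 0 \<Longrightarrow> x \<bullet> (Q *v x) < 0"
  using pos_def_inner_pos[of "- Q" x] by (simp add: neg_def_def uminus_matrix_vector)

lemma neg_def_inner_nonpos: "neg_def Q \<Longrightarrow> x \<bullet> (Q *v x) \<le> 0"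
  by (cases "x = 0") (auto simp: less_imp_le neg_def_inner_neg)

lemma neg_def_symmetric: "neg_def Q \<Longrightarrow> symmetric_mat Q"
  by (simp add: neg_def_def pos_def_def symmetric_mat_def transpose_def vec_eq_iff)

lemma neg_def_invertible:
  fixes Q :: "real ^ 'n::finite ^ 'n"
  assumes "neg_def Q"
  shows "invertible Q"
proof -
  have "x = 0" if "Q *v x = 0" for x
    using neg_def_inner_neg[OF assms, of x] that by auto
  then show ?thesis
    using invertible_left_inverse matrix_left_invertible_ker by blast
qed

lemma matrix_inv_mult:
  fixes P :: "real ^ 'n::finite ^ 'n"
  assumes "invertible P"
  shows "P ** matrix_inv P = mat 1" "matrix_inv P ** P = mat 1"
  using assms unfolding invertible_def matrix_inv_def by (metis (mono_tags, lifting) someI_ex)+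

lemma matrix_inv_cancel:
  fixes P :: "real ^ 'n::finite ^ 'n"
  assumes "invertible P"
  shows "P *v (matrix_inv P *v x) = x" "matrix_inv P *v (P *v x) = x"
  using matrix_inv_mult[OF assms] by (simp_all add: matrix_vector_mul_assoc)

text \<open>
  Testing with \<open>vcat 0 y\<close> isolates the last diagonal block. It is how the
  matrix inequality yields that \<open>P k\<close> is positive definite, hence that the gain is well defined.
\<close>

lemma pos_def_sym_block_corner:
  fixes A :: "real ^ 'a::finite ^ 'a" and D :: "real ^ 'b::finite ^ 'b"
  assumes "pos_def (sym_block A B D)" "symmetric_mat D"
  shows "pos_def D"
proof -
  have "0 < y \<bullet> (D *v y)" if "y \<noteq> 0" for y
    using pos_def_inner_pos[OF assms(1), of "vcat 0 y"] that
    by (simp add: inner_sym_block vcat_eq_0_iff)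
  with assms(2) show ?thesis by (simp add: pos_def_def)
qed

section \<open>Data representation of the closed loop\<close>

text \<open>
  The true state is not measured, so \<open>A\<close> and \<open>B\<close> act on the noisy data only up to an error.
  Substituting \<open>x = \<zeta> - v\<close> in the dynamics collects this error into the single matrix
  \<open>W = A V - V' - D\<close>, whose size is what the noise bound controls.
\<close>

lemma data_equation:
  assumes "\<And>j. xd j (Suc k) = A *v xd j k + B *v ud j k + dd j k"
    and "\<And>j. \<zeta>d j k = xd j k + vd j k" "\<And>j. \<zeta>d j (Suc k) = xd j (Suc k) + vd j (Suc k)"
  shows "A ** data_matrix \<zeta>d k + B ** data_matrix ud k
    = data_matrix \<zeta>d (Suc k)
      + (A ** data_matrix vd k - data_matrix vd (Suc k) - data_matrix dd k)"
proof -
  have mult: "(E ** data_matrix s i) $ r $ j = (E *v s j i) $ r"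
    for E :: "real ^ 'k::finite ^ 'r::finite" and s :: "'l::finite \<Rightarrow> _" and i r j
    by (simp add: data_matrix_def matrix_matrix_mult_def matrix_vector_mult_def)
  show ?thesis
    by (simp add: vec_eq_iff mult assms matrix_vector_right_distrib)
      (simp add: data_matrix_def assms)
qed

text \<open>
  The columns of \<open>Y\<close> and \<open>M\<close> combine experiments: \<open>Y\<close> reproduces the state \<open>P\<close> under the input
  \<open>K P\<close>, and \<open>M\<close> produces a zero state with a unit input. Multiplying the data equation by them
  therefore eliminates \<open>A\<close> and \<open>B\<close> in favour of the data and the unknown \<open>W\<close>.
\<close>

lemma closed_loop_from_data:
  fixes A :: "real ^ 'n::finite ^ 'n" and B :: "real ^ 'm::finite ^ 'n"
    and Z Z' W :: "real ^ 'l::finite ^ 'n" and U :: "real ^ 'l ^ 'm"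
    and Y :: "real ^ 'n ^ 'l" and M :: "real ^ 'm ^ 'l" and P :: "real ^ 'n ^ 'n"
    and C :: "real ^ 'n ^ 'q::finite" and Du :: "real ^ 'm ^ 'q"
  assumes data: "A ** Z + B ** U = Z' + W"
    and ZY: "Z ** Y = P" and M: "vcat 0 (mat 1) = vcat Z U ** M" and P: "invertible P"
  defines "K \<equiv> U ** Y ** matrix_inv P"
  shows "(A + B ** K) ** P = Z' ** Y + W ** Y"
    and "(C + Du ** K) ** P = C ** P + Du ** U ** Y"
    and "hcat B (mat 1) = hcat (Z' ** M) (mat 1) + W ** hcat M 0"
proof -
  have KP: "K ** P = U ** Y"
    by (simp add: K_def matrix_mul_assoc[symmetric] matrix_inv_mult(2)[OF P])
  have "(A + B ** K) ** P = (A ** Z + B ** U) ** Y"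
    by (simp add: KP ZY matrix_add_distrib_right matrix_mul_assoc[symmetric])
  then show "(A + B ** K) ** P = Z' ** Y + W ** Y"
    by (simp add: data matrix_add_distrib_right)
  show "(C + Du ** K) ** P = C ** P + Du ** U ** Y"
    by (simp add: KP matrix_add_distrib_right matrix_mul_assoc[symmetric])
  have "Z ** M = 0" and "U ** M = mat 1"
    using M by (auto simp: vcat_mult vcat_inject)
  then have "(A ** Z + B ** U) ** M = B"
    by (simp add: matrix_add_distrib_right matrix_mul_assoc[symmetric])
  then have B: "B = Z' ** M + W ** M"
    by (simp add: data matrix_add_distrib_right)
  show "hcat B (mat 1) = hcat (Z' ** M) (mat 1) + W ** hcat M 0"
    unfolding matrix_eq
  proof
    fix y :: "real ^ ('m + 'n)"
    obtain u v where y: "y = vcat u v" by (rule vcat_surj)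
    show "hcat B (mat 1) *v y = (hcat (Z' ** M) (mat 1) + W ** hcat M 0) *v y"
      by (simp add: y B hcat_mult_vec matrix_vector_mult_add_rdistrib
          matrix_vector_mul_assoc[symmetric] matrix_vector_mult_0)
  qed
qed

section \<open>The dual dissipation inequality\<close>

text \<open>
  The noise bound as a quadratic form in \<open>a\<close>, with \<open>c\<close> standing for the value \<open>transpose W *v a\<close>
  at which the third block of the matrix inequality will be tested.
\<close>

lemma uncertain_block_nonneg:
  fixes W :: "real ^ 'l::finite ^ 'n::finite" and a :: "real ^ 'n"
  assumes "pos_semidef (transpose (vcat (mat 1) (transpose W))
          ** vcat (hcat Qr Sr) (hcat (transpose Sr) Rr) ** vcat (mat 1) (transpose W))"
  defines "c \<equiv> transpose W *v a"
  shows "0 \<le> a \<bullet> (Qr *v a) + 2 * (c \<bullet> (transpose Sr *v a)) + c \<bullet> (Rr *v c)"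
proof -
  have "vcat (mat 1) (transpose W) *v a = vcat a c"
    by (simp add: vcat_mult_vec c_def)
  moreover have "0 \<le> a \<bullet> ((transpose (vcat (mat 1) (transpose W))
          ** vcat (hcat Qr Sr) (hcat (transpose Sr) Rr) ** vcat (mat 1) (transpose W)) *v a)"
    using assms(1) by (simp add: pos_semidef_def)
  ultimately have "0 \<le> vcat a c \<bullet> (vcat (hcat Qr Sr) (hcat (transpose Sr) Rr) *v vcat a c)"
    by (simp add: matrix_vector_mul_assoc[symmetric] inner_transpose_right)
  then show ?thesis
    by (simp add: vcat_mult_vec hcat_mult_vec inner_vcat inner_add_right inner_transpose_right
        inner_commute)
qed

text \<open>
  This is a combined S-procedure and Schur complement step, done by choosing test vectors. In the
  third block, \<open>c = transpose W *v a\<close> replaces the data matrices by the closed-loop ones,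
  and the terms in \<open>Qr\<close>, \<open>Sr\<close>, \<open>Rr\<close> add up to minus the nonnegative noise form, so they can
  be dropped. In the last two blocks, \<open>d = Q' *v g\<close> and \<open>e = - h\<close> are the minimizers of the
  quadratic form; with them the blocks contribute \<open>g \<bullet> (Q' *v g)\<close> and \<open>- h \<bullet> (P0 *v h)\<close>.
  The result is a dissipation inequality for the adjoint system, which runs backwards from
  \<open>(a, b)\<close> to \<open>(h, g)\<close>.
\<close>

lemma dual_dissipation:
  fixes W :: "real ^ 'l::finite ^ 'n::finite"
    and E :: "real ^ 'w::finite ^ 'n" and Dcl :: "real ^ 'w ^ 'q::finite"
    and a :: "real ^ 'n" and b :: "real ^ 'q"
  assumes LMI: "pos_def
        (sym_block (sym_block (sym_block (sym_block
          (P1 - Qr)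
          (- (transpose S' ** transpose E))
            (- (Dcl ** S') - transpose S' ** transpose Dcl + R'))
          (hcat (- transpose Sr) (- (M ** S')))
            (- Rr))
          (hcat (hcat (transpose E) (transpose Dcl)) (transpose M))
            (- matrix_inv Q'))
          (hcat (hcat (hcat (transpose G) (transpose H)) (transpose Y)) 0)
            P0)"
    and W_bound: "pos_semidef
        (transpose (vcat (mat 1) (transpose W))
          ** vcat (hcat Qr Sr) (hcat (transpose Sr) Rr) ** vcat (mat 1) (transpose W))"
    and Q'_neg: "neg_def Q'"
    and P0_sym: "symmetric_mat P0"
    and Acl: "Acl ** P0 = G + W ** Y" and Ccl: "Ccl ** P0 = H" and Bcl: "Bcl = E + W ** M"
    and nonzero: "a \<noteq> 0 \<or> b \<noteq> 0"
  defines "h \<equiv> transpose Acl *v a + transpose Ccl *v b"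
    and "g \<equiv> transpose Bcl *v a + transpose Dcl *v b"
  shows "0 < a \<bullet> (P1 *v a) - h \<bullet> (P0 *v h) + b \<bullet> (R' *v b) - 2 * (b \<bullet> (transpose S' *v g))
           + g \<bullet> (Q' *v g)"
proof -
  define c where "c = transpose W *v a"
  define d where "d = Q' *v g"
  define e where "e = - h"
  have nonzero_vec: "vcat (vcat (vcat (vcat a b) c) d) e \<noteq> 0"
    using nonzero by (auto simp: vcat_eq_0_iff)
  have full: "0 < a \<bullet> (P1 *v a) - a \<bullet> (Qr *v a)
      - 2 * (b \<bullet> (transpose S' *v (transpose E *v a)))
      - b \<bullet> (Dcl *v (S' *v b)) - b \<bullet> (transpose S' *v (transpose Dcl *v b)) + b \<bullet> (R' *v b)
      - 2 * (c \<bullet> (transpose Sr *v a)) - 2 * (c \<bullet> (M *v (S' *v b))) - c \<bullet> (Rr *v c)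
      + 2 * (d \<bullet> (transpose E *v a)) + 2 * (d \<bullet> (transpose Dcl *v b)) + 2 * (d \<bullet> (transpose M *v c))
      - d \<bullet> (matrix_inv Q' *v d)
      + 2 * (e \<bullet> (transpose G *v a)) + 2 * (e \<bullet> (transpose H *v b)) + 2 * (e \<bullet> (transpose Y *v c))
      + e \<bullet> (P0 *v e)"
    using pos_def_inner_pos[OF LMI nonzero_vec]
    by (simp add: inner_sym_block hcat_mult_vec uminus_matrix_vector
        matrix_vector_mult_add_rdistrib matrix_vector_mult_diff_rdistrib matrix_vector_mult_0
        inner_add_right inner_diff_right matrix_vector_mul_assoc[symmetric] algebra_simps)
  have g_inner: "v \<bullet> g = v \<bullet> (transpose E *v a) + v \<bullet> (transpose M *v c) + v \<bullet> (transpose Dcl *v b)" for v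
    by (simp add: g_def c_def Bcl inner_add_right inner_transpose_right
        matrix_vector_mult_add_rdistrib inner_add_left matrix_vector_mul_assoc[symmetric])
  have AclP: "Acl *v (P0 *v v) = G *v v + W *v (Y *v v)" and CclP: "Ccl *v (P0 *v v) = H *v v" for v
    by (simp_all add: matrix_vector_mul_assoc Acl Ccl matrix_vector_mult_add_rdistrib)
  have h_inner: "(P0 *v v) \<bullet> h = v \<bullet> (transpose G *v a) + v \<bullet> (transpose Y *v c) + v \<bullet> (transpose H *v b)" for v
    by (simp add: h_def c_def inner_add_right inner_transpose_right inner_add_left AclP CclP)
  \<comment> \<open>the block of \<open>d\<close> contributes \<open>2 * (d \<bullet> g) - d \<bullet> g\<close>\<close>
  have dd: "d \<bullet> (matrix_inv Q' *v d) = d \<bullet> g"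
    by (simp add: d_def matrix_inv_cancel neg_def_invertible[OF Q'_neg])
  have cross: "b \<bullet> (transpose S' *v g) = b \<bullet> (transpose S' *v (transpose E *v a))
      + c \<bullet> (M *v (S' *v b)) + b \<bullet> (Dcl *v (S' *v b))"
    using g_inner[of "S' *v b"] by (simp add: inner_transpose_right inner_commute)
  have bb: "b \<bullet> (transpose S' *v (transpose Dcl *v b)) = b \<bullet> (Dcl *v (S' *v b))"
    by (simp add: inner_transpose_right inner_commute)
  have "P0 *v e = - (P0 *v h)" by (simp add: e_def vec.neg)
  then have ee: "e \<bullet> (P0 *v e) = h \<bullet> (P0 *v h)" "(P0 *v e) \<bullet> h = - (h \<bullet> (P0 *v h))"
    by (simp_all add: e_def inner_commute)
  have "d \<bullet> g = g \<bullet> (Q' *v g)" by (simp add: d_def inner_commute)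
  then show ?thesis
    using full uncertain_block_nonneg[OF W_bound, of a] g_inner[of d] h_inner[of e] dd cross bb ee
    unfolding c_def[symmetric] by linarith
qed

text \<open>
  With \<open>b = 0\<close>, the terms in \<open>P0\<close> and \<open>Q'\<close> are nonpositive, so the term in \<open>P1\<close> alone must be
  positive. This covers the final time, at which \<open>P\<close> is not the last diagonal block of a matrix
  inequality.
\<close>

lemma next_storage_pos_def:
  fixes P1 :: "real ^ 'n::finite ^ 'n"
  assumes dual: "\<And>a b. a \<noteq> 0 \<or> b \<noteq> 0 \<Longrightarrow>
        let h = transpose Acl *v a + transpose Ccl *v b; g = transpose Bcl *v a + transpose Dcl *v b
        in 0 < a \<bullet> (P1 *v a) - h \<bullet> (P0 *v h) + b \<bullet> (R' *v b)
             - 2 * (b \<bullet> (transpose S' *v g)) + g \<bullet> (Q' *v g)"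
    and P0: "pos_def P0" and Q'_neg: "neg_def Q'" and P1_sym: "symmetric_mat P1"
  shows "pos_def P1"
proof -
  have "0 < a \<bullet> (P1 *v a)" if "a \<noteq> 0" for a
    using dual[of a 0] that
      pos_def_inner_nonneg[OF P0, of "transpose Acl *v a"]
      neg_def_inner_nonpos[OF Q'_neg, of "transpose Bcl *v a"]
    by (simp add: Let_def)
  with P1_sym show ?thesis by (simp add: pos_def_def)
qed

section \<open>From the dual to the primal inequality\<close>

text \<open>
  Let \<open>\<Sigma>\<close> be the block diagonal form with blocks \<open>- matrix_inv P0\<close>, the performance index and
  \<open>matrix_inv P1\<close>, on the slots state, \<open>(w, z)\<close> and next state. The primal inequality says that
  \<open>\<Sigma>\<close> is negative on the closed-loop trajectories \<open>u = (x, w, z, x')\<close>. The dual one says that the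
  inverse of \<open>\<Sigma>\<close> is positive on their orthogonal complement, whose elements are
  \<open>\<eta> = (- h, - g, b, a)\<close>. Since \<open>\<eta>\<close> and \<open>u\<close> are orthogonal, the inverse form at
  \<open>\<eta> + \<Sigma> u\<close> is the sum of its value at \<open>\<eta>\<close> and of \<open>\<Sigma>\<close> at \<open>u\<close>. Take \<open>a\<close> and \<open>b\<close> to
  cancel the slots \<open>x'\<close> and \<open>z\<close> of \<open>\<Sigma> u\<close>: what is left of \<open>\<eta> + \<Sigma> u\<close> lies in the slots
  of \<open>x\<close> and \<open>w\<close>, where the inverse form is given by \<open>- P0\<close> and \<open>Q'\<close> and so is nonpositive.
  Hence \<open>\<Sigma>\<close> at \<open>u\<close> is at most minus the dual form at \<open>(a, b)\<close>, without any counting of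
  eigenvalues.
\<close>

lemma primal_dissipation:
  fixes Acl :: "real ^ 'n::finite ^ 'n" and Bcl :: "real ^ 'w::finite ^ 'n"
    and Ccl :: "real ^ 'n ^ 'q::finite" and Dcl :: "real ^ 'w ^ 'q"
    and x :: "real ^ 'n" and w :: "real ^ 'w"
    and Q Q' :: "real ^ 'w ^ 'w" and S S' :: "real ^ 'q ^ 'w" and R R' :: "real ^ 'q ^ 'q"
  assumes P0: "pos_def P0" and P1: "pos_def P1" and Q'_neg: "neg_def Q'"
    and inverse: "vcat (hcat Q' S') (hcat (transpose S') R')
        ** vcat (hcat Q S) (hcat (transpose S) R) = mat 1"
    and dual: "\<And>a b. a \<noteq> 0 \<or> b \<noteq> 0 \<Longrightarrow>
        let h = transpose Acl *v a + transpose Ccl *v b; g = transpose Bcl *v a + transpose Dcl *v b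
        in 0 < a \<bullet> (P1 *v a) - h \<bullet> (P0 *v h) + b \<bullet> (R' *v b)
             - 2 * (b \<bullet> (transpose S' *v g)) + g \<bullet> (Q' *v g)"
    and nonzero: "x \<noteq> 0 \<or> w \<noteq> 0"
  defines "x' \<equiv> Acl *v x + Bcl *v w" and "z \<equiv> Ccl *v x + Dcl *v w"
  shows "x' \<bullet> (matrix_inv P1 *v x') - x \<bullet> (matrix_inv P0 *v x)
      + vcat w z \<bullet> (vcat (hcat Q S) (hcat (transpose S) R) *v vcat w z) < 0"
proof -
  \<comment> \<open>\<open>(p, r)\<close> and \<open>\<alpha>\<close>, \<open>- \<xi>\<close> are the components of \<open>\<Sigma> u\<close>\<close>
  define p where "p = Q *v w + S *v z"
  define r where "r = transpose S *v w + R *v z"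
  have index: "vcat (hcat Q S) (hcat (transpose S) R) *v vcat w z = vcat p r"
    by (simp add: vcat_mult_vec hcat_mult_vec p_def r_def)
  have "vcat (hcat Q' S') (hcat (transpose S') R') *v vcat p r = vcat w z"
    by (simp add: index[symmetric] matrix_vector_mul_assoc inverse)
  then have w: "w = Q' *v p + S' *v r" and z: "z = transpose S' *v p + R' *v r"
    by (simp_all add: vcat_mult_vec hcat_mult_vec vcat_inject)
  define \<alpha> where "\<alpha> = matrix_inv P1 *v x'"
  define \<xi> where "\<xi> = matrix_inv P0 *v x"
  have P1\<alpha>: "P1 *v \<alpha> = x'" and P0\<xi>: "P0 *v \<xi> = x"
    by (simp_all add: \<alpha>_def \<xi>_def matrix_inv_cancel pos_def_invertible P0 P1)
  \<comment> \<open>the dual inequality is used at \<open>a = - \<alpha>\<close> and \<open>b = - r\<close>\<close>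
  define h where "h = transpose Acl *v (- \<alpha>) + transpose Ccl *v (- r)"
  define g where "g = transpose Bcl *v (- \<alpha>) + transpose Dcl *v (- r)"
  define DD where "DD = (- \<alpha>) \<bullet> (P1 *v (- \<alpha>)) - h \<bullet> (P0 *v h) + (- r) \<bullet> (R' *v (- r))
             - 2 * ((- r) \<bullet> (transpose S' *v g)) + g \<bullet> (Q' *v g)"
  have Q'_sym: "symmetric_mat Q'" and P0_sym: "symmetric_mat P0"
    using Q'_neg P0 by (auto simp: neg_def_symmetric pos_def_def)
  \<comment> \<open>orthogonality of the dual element to the trajectory\<close>
  have orth: "h \<bullet> x + g \<bullet> w = - (\<alpha> \<bullet> x') - r \<bullet> z"
    by (simp add: h_def g_def x'_def z_def inner_add_right inner_diff_left inner_transpose_left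
        vec.neg)
  have sq1: "(h + \<xi>) \<bullet> (P0 *v (h + \<xi>)) = h \<bullet> (P0 *v h) + 2 * (h \<bullet> x) + x \<bullet> \<xi>"
    using symmetric_mat_inner[OF P0_sym, of \<xi> h]
    by (simp add: matrix_vector_right_distrib inner_add_left inner_add_right P0\<xi> inner_commute)
  have sq2: "(p - g) \<bullet> (Q' *v (p - g)) = p \<bullet> (Q' *v p) - 2 * (g \<bullet> (Q' *v p)) + g \<bullet> (Q' *v g)"
    using symmetric_mat_inner[OF Q'_sym, of p g]
    by (simp add: matrix_vector_mult_diff_distrib inner_diff_left inner_diff_right inner_commute)
  have gw: "g \<bullet> w = g \<bullet> (Q' *v p) + r \<bullet> (transpose S' *v g)"
    using w by (simp add: inner_add_right inner_transpose_right inner_commute)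
  have wp: "w \<bullet> p = p \<bullet> (Q' *v p) + r \<bullet> (transpose S' *v p)"
    using w by (simp add: inner_add_left inner_add_right inner_transpose_right inner_commute)
  have rz: "r \<bullet> z = r \<bullet> (transpose S' *v p) + r \<bullet> (R' *v r)"
    using z by (simp add: inner_add_right)
  have DD: "DD = \<alpha> \<bullet> x' - h \<bullet> (P0 *v h) + r \<bullet> (R' *v r)
      + 2 * (r \<bullet> (transpose S' *v g)) + g \<bullet> (Q' *v g)"
    by (simp add: DD_def vec.neg P1\<alpha>)
  have identity: "x' \<bullet> \<alpha> - x \<bullet> \<xi> + (w \<bullet> p + z \<bullet> r)
      = (p - g) \<bullet> (Q' *v (p - g)) - (h + \<xi>) \<bullet> (P0 *v (h + \<xi>)) - DD"
    using orth sq1 sq2 gw wp rz DD inner_commute[of z r] inner_commute[of x' \<alpha>] by linarith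
  have "(p - g) \<bullet> (Q' *v (p - g)) - (h + \<xi>) \<bullet> (P0 *v (h + \<xi>)) - DD < 0"
  proof (cases "\<alpha> = 0 \<and> r = 0")
    case False
    then have "0 < DD"
      using dual[of "- \<alpha>" "- r"] by (simp add: DD_def h_def g_def Let_def)
    then show ?thesis
      using neg_def_inner_nonpos[OF Q'_neg, of "p - g"] pos_def_inner_nonneg[OF P0, of "h + \<xi>"]
      by linarith
  next
    case True
    then have "h = 0" "g = 0" "DD = 0" by (simp_all add: h_def g_def DD_def)
    \<comment> \<open>the dual form vanishes here, so strictness has to come from \<open>P0\<close> or \<open>Q'\<close>\<close>
    moreover have "p \<noteq> 0 \<or> \<xi> \<noteq> 0"
    proof (rule ccontr)
      assume "\<not> (p \<noteq> 0 \<or> \<xi> \<noteq> 0)"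
      with True w P0\<xi> have "w = 0" "x = 0" by auto
      with nonzero show False by simp
    qed
    ultimately show ?thesis
      using neg_def_inner_nonpos[OF Q'_neg, of p] pos_def_inner_nonneg[OF P0, of \<xi>]
        neg_def_inner_neg[OF Q'_neg, of p] pos_def_inner_pos[OF P0, of \<xi>]
      by auto
  qed
  then have "x' \<bullet> \<alpha> - x \<bullet> \<xi> + (w \<bullet> p + z \<bullet> r) < 0"
    unfolding identity .
  then show ?thesis
    by (simp add: index inner_vcat \<alpha>_def \<xi>_def)
qed

section \<open>Uniform margin and terminal cost\<close>

text \<open>
  By compactness, the maximum over the unit sphere is attained and hence negative; homogeneity
  spreads it to the whole space.
\<close>

lemma neg_quadratic_margin:
  fixes f :: "'a::euclidean_space \<Rightarrow> real"
  assumes cont: "continuous_on UNIV f" and homogeneous: "\<And>c x. f (c *\<^sub>R x) = c\<^sup>2 * f x"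
    and neg: "\<And>x. x \<noteq> 0 \<Longrightarrow> f x < 0"
  obtains \<epsilon> where "0 < \<epsilon>" "\<And>x. f x + \<epsilon> * (norm x)\<^sup>2 \<le> 0"
proof -
  obtain u :: 'a where "u \<in> sphere 0 1" and u: "\<And>y. y \<in> sphere 0 1 \<Longrightarrow> f y \<le> f u"
    using continuous_attains_sup[of "sphere (0::'a) 1" f] continuous_on_subset[OF cont]
    by auto
  then have "u \<noteq> 0" by auto
  then have "0 < - f u" using neg[of u] by simp
  moreover have "f x + (- f u) * (norm x)\<^sup>2 \<le> 0" for x
  proof (cases "x = 0")
    case True
    then show ?thesis using homogeneous[of 0 x] by simp
  next
    case False
    have "f x = (norm x)\<^sup>2 * f (sgn x)"
      using homogeneous[of "norm x" "sgn x"] False by (simp add: sgn_div_norm)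
    moreover have "f (sgn x) \<le> f u" using False by (intro u) (simp add: norm_sgn)
    ultimately show ?thesis using mult_left_mono[of "f (sgn x)" "f u" "(norm x)\<^sup>2"] by (simp add: mult.commute)
  qed
  ultimately show ?thesis by (rule that)
qed

lemma continuous_on_matrix_vector:
  "continuous_on T f \<Longrightarrow> continuous_on T (\<lambda>x. (A :: real ^ 'n::finite ^ 'm::finite) *v f x)"
  by (rule continuous_on_compose2[OF linear_continuous_on[of "(*v) A" UNIV]])
    (auto intro: linear_linear[THEN iffD2] matrix_vector_mul_bounded_linear)

text \<open>
  The margin is taken jointly in \<open>(x, w)\<close> and only its part in \<open>w\<close> is kept.
\<close>

lemma strict_dissipation:
  fixes Acl :: "real ^ 'n::finite ^ 'n" and Bcl :: "real ^ 'w::finite ^ 'n"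
    and Ccl :: "real ^ 'n ^ 'q::finite" and Dcl :: "real ^ 'w ^ 'q"
  assumes "\<And>x w. x \<noteq> 0 \<or> w \<noteq> 0 \<Longrightarrow>
      let x' = Acl *v x + Bcl *v w; z = Ccl *v x + Dcl *v w
      in x' \<bullet> (V1 *v x') - x \<bullet> (V0 *v x) + vcat w z \<bullet> (vcat (hcat Q S) (hcat (transpose S) R) *v vcat w z) < 0"
  obtains \<epsilon> where "0 < \<epsilon>"
    "\<And>x w. let x' = Acl *v x + Bcl *v w; z = Ccl *v x + Dcl *v w
      in x' \<bullet> (V1 *v x') - x \<bullet> (V0 *v x) + vcat w z \<bullet> (vcat (hcat Q S) (hcat (transpose S) R) *v vcat w z)
         + \<epsilon> * (w \<bullet> w) \<le> 0"
proof -
  define f where "f = (\<lambda>(x, w). let x' = Acl *v x + Bcl *v w; z = Ccl *v x + Dcl *v w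
      in x' \<bullet> (V1 *v x') - x \<bullet> (V0 *v x) + vcat w z \<bullet> (vcat (hcat Q S) (hcat (transpose S) R) *v vcat w z))"
  have f: "f y = (let x = fst y; w = snd y; x' = Acl *v x + Bcl *v w; z = Ccl *v x + Dcl *v w
      in x' \<bullet> (V1 *v x') - x \<bullet> (V0 *v x) + (w \<bullet> (Q *v w + S *v z) + z \<bullet> (transpose S *v w + R *v z)))" for y
    by (simp add: f_def Let_def case_prod_beta vcat_mult_vec hcat_mult_vec inner_vcat)
  have cont: "continuous_on UNIV f"
    unfolding f Let_def
    by (intro continuous_intros continuous_on_matrix_vector)
  have hom: "f (c *\<^sub>R y) = c\<^sup>2 * f y" for c y
    by (simp add: f Let_def matrix_vector_mult_scaleR scaleR_add_right[symmetric] power2_eq_square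
        algebra_simps)
  have neg: "f y < 0" if "y \<noteq> 0" for y
    using assms[of "fst y" "snd y"] that by (auto simp: f_def case_prod_beta prod_eq_iff Let_def)
  obtain \<epsilon> where \<epsilon>: "0 < \<epsilon>" "\<And>y. f y + \<epsilon> * (norm y)\<^sup>2 \<le> 0"
    using neg_quadratic_margin[OF cont hom neg] by blast
  have "f (x, w) + \<epsilon> * (w \<bullet> w) \<le> 0" for x w
  proof -
    have "w \<bullet> w \<le> (norm (x, w))\<^sup>2"
      by (simp add: power2_norm_eq_inner)
    then show ?thesis using \<epsilon>(2)[of "(x, w)"] mult_left_mono[of "w \<bullet> w" _ \<epsilon>] \<epsilon>(1)
      by (smt (verit))
  qed
  then show ?thesis using \<epsilon>(1) that by (simp add: f_def Let_def)
qed

text \<open>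
  The inequalities \<open>C P C\<^sup>T \<le> I\<close> and \<open>C\<^sup>T C \<le> P\<^sup>-\<^sup>1\<close> are equivalent by a Schur complement. Here the
  second follows by expanding the nonnegative square of \<open>\<xi> - C\<^sup>T C x\<close> in the metric \<open>P\<close>, where
  \<open>P \<xi> = x\<close>.
\<close>

lemma terminal_bound:
  fixes C :: "real ^ 'n::finite ^ 'q::finite"
  assumes P: "pos_def P" and terminal: "pos_semidef (mat 1 - C ** P ** transpose C)"
  shows "(C *v x) \<bullet> (C *v x) \<le> x \<bullet> (matrix_inv P *v x)"
proof -
  define \<xi> where "\<xi> = matrix_inv P *v x"
  define y where "y = C *v x"
  define t where "t = transpose C *v y"
  have P\<xi>: "P *v \<xi> = x"
    by (simp add: \<xi>_def matrix_inv_cancel pos_def_invertible P)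
  have tx: "t \<bullet> x = y \<bullet> y"
    by (simp add: t_def y_def inner_transpose_left)
  have "0 \<le> y \<bullet> ((mat 1 - C ** P ** transpose C) *v y)"
    using terminal by (simp add: pos_semidef_def)
  then have "t \<bullet> (P *v t) \<le> y \<bullet> y"
    by (simp add: t_def matrix_vector_mult_diff_rdistrib matrix_vector_mul_assoc[symmetric]
        inner_diff_right inner_transpose_left)
  moreover have "0 \<le> (\<xi> - t) \<bullet> (P *v (\<xi> - t))"
    using pos_def_inner_nonneg[OF P] .
  moreover have "\<xi> \<bullet> (P *v t) = t \<bullet> x"
    using P P\<xi> by (metis pos_def_def symmetric_mat_inner inner_commute)
  ultimately show ?thesis
    using tx unfolding \<xi>_def[symmetric] y_def[symmetric]
    by (simp add: matrix_vector_mult_diff_distrib inner_diff_left inner_diff_right P\<xi> inner_commute)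
qed

section \<open>Robust quadratic performance\<close>

theorem theorem4:
  fixes N :: nat
    and A :: "nat \<Rightarrow> real ^ 'n::finite ^ 'n"
    and B :: "nat \<Rightarrow> real ^ 'm::finite ^ 'n"
    and xd \<zeta>d vd dd :: "'l::finite \<Rightarrow> nat \<Rightarrow> real ^ 'n"
    and ud :: "'l \<Rightarrow> nat \<Rightarrow> real ^ 'm"
    and Z V D W :: "nat \<Rightarrow> real ^ 'l ^ 'n"
    and U :: "nat \<Rightarrow> real ^ 'l ^ 'm"
    and Qr :: "nat \<Rightarrow> real ^ 'n ^ 'n"
    and Sr :: "nat \<Rightarrow> real ^ 'l ^ 'n"
    and Rr :: "nat \<Rightarrow> real ^ 'l ^ 'l"
    and C :: "nat \<Rightarrow> real ^ 'n ^ 'q::finite"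
    and Du :: "nat \<Rightarrow> real ^ 'm ^ 'q"
    and Dd :: "nat \<Rightarrow> real ^ 'n ^ 'q"
    and Qp Qp' :: "nat \<Rightarrow> real ^ ('m + 'n) ^ ('m + 'n)"
    and Sp Sp' :: "nat \<Rightarrow> real ^ 'q ^ ('m + 'n)"
    and Rp Rp' :: "nat \<Rightarrow> real ^ 'q ^ 'q"
    and Y :: "nat \<Rightarrow> real ^ 'n ^ 'l"
    and M :: "nat \<Rightarrow> real ^ 'm ^ 'l"
    and P :: "nat \<Rightarrow> real ^ 'n ^ 'n"
    and Ecl :: "nat \<Rightarrow> real ^ ('m + 'n) ^ 'n"
    and Mbar :: "nat \<Rightarrow> real ^ ('m + 'n) ^ 'l"
    and Dcl :: "nat \<Rightarrow> real ^ ('m + 'n) ^ 'q"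
    and K :: "nat \<Rightarrow> real ^ 'n ^ 'm"
  assumes data_dynamics:
      "\<And>j k. k < N \<Longrightarrow> xd j (Suc k) = A k *v xd j k + B k *v ud j k + dd j k"
    and data_measurement: "\<And>j k. k \<le> N \<Longrightarrow> \<zeta>d j k = xd j k + vd j k"
    and Z_eq: "\<And>k. k \<le> N \<Longrightarrow> Z k = data_matrix \<zeta>d k"
    and V_eq: "\<And>k. k \<le> N \<Longrightarrow> V k = data_matrix vd k"
    and U_eq: "\<And>k. k < N \<Longrightarrow> U k = data_matrix ud k"
    and D_eq: "\<And>k. k < N \<Longrightarrow> D k = data_matrix dd k"
    and full_rank: "\<And>k. k < N \<Longrightarrow> rank (vcat (Z k) (U k)) = CARD('n) + CARD('m)"
    and W_eq: "\<And>k. k < N \<Longrightarrow> W k = A k ** V k - V (Suc k) - D k"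
    and Qr_sym: "\<And>k. k < N \<Longrightarrow> symmetric_mat (Qr k)"
    and Rr_sym: "\<And>k. k < N \<Longrightarrow> symmetric_mat (Rr k)"
    and Rr_neg: "\<And>k. k < N \<Longrightarrow> neg_def (Rr k)"
    and W_bound: "\<And>k. k < N \<Longrightarrow> pos_semidef
        (transpose (vcat (mat 1) (transpose (W k)))
          ** vcat (hcat (Qr k) (Sr k)) (hcat (transpose (Sr k)) (Rr k))
          ** vcat (mat 1) (transpose (W k)))"
    and Qp_sym: "\<And>k. k < N \<Longrightarrow> symmetric_mat (Qp k)"
    and Rp_sym: "\<And>k. k < N \<Longrightarrow> symmetric_mat (Rp k)"
    and Rp_nonneg: "\<And>k. k < N \<Longrightarrow> pos_semidef (Rp k)"
    and index_invertible: "\<And>k. k < N \<Longrightarrow>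
        invertible (vcat (hcat (Qp k) (Sp k)) (hcat (transpose (Sp k)) (Rp k)))"
    and index_inverse: "\<And>k. k < N \<Longrightarrow>
        matrix_inv (vcat (hcat (Qp k) (Sp k)) (hcat (transpose (Sp k)) (Rp k)))
          = vcat (hcat (Qp' k) (Sp' k)) (hcat (transpose (Sp' k)) (Rp' k))"
    and Qp'_neg: "\<And>k. k < N \<Longrightarrow> neg_def (Qp' k)"
    and Ecl_eq: "\<And>k. k < N \<Longrightarrow> Ecl k = hcat (Z (Suc k) ** M k) (mat 1)"
    and Mbar_eq: "\<And>k. k < N \<Longrightarrow> Mbar k = hcat (M k) 0"
    and Dcl_eq: "\<And>k. k < N \<Longrightarrow> Dcl k = hcat (Du k) (Dd k)"
    and P_sym: "\<And>k. k \<le> N \<Longrightarrow> symmetric_mat (P k)"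
    and LMI: "\<And>k. k < N \<Longrightarrow> pos_def
        (sym_block (sym_block (sym_block (sym_block
          (P (Suc k) - Qr k)
          (- (transpose (Sp' k) ** transpose (Ecl k)))
            (- (Dcl k ** Sp' k) - transpose (Sp' k) ** transpose (Dcl k) + Rp' k))
          (hcat (- transpose (Sr k))
                (- (Mbar k ** Sp' k)))
            (- Rr k))
          (hcat (hcat (transpose (Ecl k))
                      (transpose (Dcl k)))
                (transpose (Mbar k)))
            (- matrix_inv (Qp' k)))
          (hcat (hcat (hcat (transpose (Z (Suc k) ** Y k))
                            (transpose (C k ** P k + Du k ** U k ** Y k)))
                      (transpose (Y k)))
                0)
            (P k))"
    and ZY_eq: "\<And>k. k < N \<Longrightarrow> Z k ** Y k = P k"
    and M_eq: "\<And>k. k < N \<Longrightarrow> vcat 0 (mat 1) = vcat (Z k) (U k) ** M k"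
    and terminal: "pos_semidef (mat 1 - C N ** P N ** transpose (C N))"
    and K_eq: "\<And>k. k < N \<Longrightarrow> K k = U k ** Y k ** matrix_inv (P k)"
  shows "\<exists>\<epsilon>>0. \<forall>w \<in> (ell2 :: (nat \<Rightarrow> real ^ ('m + 'n)) set).
    \<forall>(x :: nat \<Rightarrow> real ^ 'n) (z :: nat \<Rightarrow> real ^ 'q) (zf :: real ^ 'q).
      x 0 = 0 \<longrightarrow>
      (\<forall>k<N. x (Suc k) = (A k + B k ** K k) *v x k + hcat (B k) (mat 1) *v w k) \<longrightarrow>
      (\<forall>k<N. z k = (C k + Du k ** K k) *v x k + Dcl k *v w k) \<longrightarrow>
      zf = C N *v x N \<longrightarrow>
      zf \<bullet> zf
        + (\<Sum>k<N. vcat (w k) (z k)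
            \<bullet> (vcat (hcat (Qp k) (Sp k)) (hcat (transpose (Sp k)) (Rp k)) *v vcat (w k) (z k)))
        + \<epsilon> * (\<Sum>k<N. w k \<bullet> w k) \<le> 0"
proof -
  define Pi where "Pi k = vcat (hcat (Qp k) (Sp k)) (hcat (transpose (Sp k)) (Rp k))" for k
  define Acl where "Acl k = A k + B k ** K k" for k
  define Bcl where "Bcl k = hcat (B k) (mat 1)" for k
  define Ccl where "Ccl k = C k + Du k ** K k" for k

  have P_pos: "pos_def (P k)" if "k < N" for k
    using pos_def_sym_block_corner[OF LMI] P_sym that by simp
  have data: "A k ** Z k + B k ** U k = Z (Suc k) + W k" if "k < N" for k
    using data_equation[of xd k "A k" "B k" ud dd \<zeta>d vd] data_dynamics data_measurement
      Z_eq V_eq U_eq D_eq W_eq that by simp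
  have loop: "Acl k ** P k = Z (Suc k) ** Y k + W k ** Y k"
    "Ccl k ** P k = C k ** P k + Du k ** U k ** Y k"
    "Bcl k = Ecl k + W k ** Mbar k" if "k < N" for k
    using closed_loop_from_data[OF data ZY_eq M_eq pos_def_invertible[OF P_pos]] that
    by (simp_all add: Acl_def Bcl_def Ccl_def K_eq Ecl_eq Mbar_eq)
  have dual: "let h = transpose (Acl k) *v a + transpose (Ccl k) *v b;
          g = transpose (Bcl k) *v a + transpose (Dcl k) *v b
        in 0 < a \<bullet> (P (Suc k) *v a) - h \<bullet> (P k *v h) + b \<bullet> (Rp' k *v b)
             - 2 * (b \<bullet> (transpose (Sp' k) *v g)) + g \<bullet> (Qp' k *v g)"
    if "k < N" "a \<noteq> 0 \<or> b \<noteq> 0" for k a b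
    using dual_dissipation[OF LMI W_bound Qp'_neg P_sym loop] that by (simp add: Let_def)
  have P_Suc_pos: "pos_def (P (Suc k))" if "k < N" for k
    using next_storage_pos_def[OF dual P_pos Qp'_neg P_sym] that by simp
  have inverse: "vcat (hcat (Qp' k) (Sp' k)) (hcat (transpose (Sp' k)) (Rp' k)) ** Pi k = mat 1"
    if "k < N" for k
    using matrix_inv_mult(2)[OF index_invertible] index_inverse that by (simp add: Pi_def)
  have margin: "\<exists>\<epsilon>>0. \<forall>x w. let x' = Acl k *v x + Bcl k *v w; z = Ccl k *v x + Dcl k *v w
      in x' \<bullet> (matrix_inv (P (Suc k)) *v x') - x \<bullet> (matrix_inv (P k) *v x)
         + vcat w z \<bullet> (Pi k *v vcat w z) + \<epsilon> * (w \<bullet> w) \<le> 0" if "k < N" for k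
  proof -
    have "let x' = Acl k *v x + Bcl k *v w; z = Ccl k *v x + Dcl k *v w
      in x' \<bullet> (matrix_inv (P (Suc k)) *v x') - x \<bullet> (matrix_inv (P k) *v x)
         + vcat w z \<bullet> (Pi k *v vcat w z) < 0" if "x \<noteq> 0 \<or> w \<noteq> 0" for x w
      unfolding Let_def Pi_def
      by (rule primal_dissipation[OF P_pos P_Suc_pos Qp'_neg inverse[unfolded Pi_def] dual that])
        (use \<open>k < N\<close> in simp_all)
    from strict_dissipation[OF this[unfolded Pi_def]] show ?thesis
      unfolding Pi_def by metis
  qed
  then obtain e where e: "\<And>k. k < N \<Longrightarrow> 0 < e k"
    "\<And>k x w. k < N \<Longrightarrow> let x' = Acl k *v x + Bcl k *v w; z = Ccl k *v x + Dcl k *v w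
      in x' \<bullet> (matrix_inv (P (Suc k)) *v x') - x \<bullet> (matrix_inv (P k) *v x)
         + vcat w z \<bullet> (Pi k *v vcat w z) + e k * (w \<bullet> w) \<le> 0"
    by metis
  \<comment> \<open>the element \<open>1\<close> keeps the set nonempty when \<open>N = 0\<close>\<close>
  define \<epsilon> where "\<epsilon> = Min (insert 1 (e ` {..<N}))"
  have \<epsilon>_pos: "0 < \<epsilon>" using e(1) by (simp add: \<epsilon>_def)
  have \<epsilon>_le: "\<epsilon> \<le> e k" if "k < N" for k using that by (simp add: \<epsilon>_def)
  show ?thesis
  proof (intro exI[of _ \<epsilon>] conjI \<epsilon>_pos ballI allI impI)
    fix w :: "nat \<Rightarrow> real ^ ('m + 'n)" and x :: "nat \<Rightarrow> real ^ 'n" and z :: "nat \<Rightarrow> real ^ 'q"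
      and zf :: "real ^ 'q"
    assume x0: "x 0 = 0"
      and x: "\<forall>k<N. x (Suc k) = (A k + B k ** K k) *v x k + hcat (B k) (mat 1) *v w k"
      and z: "\<forall>k<N. z k = (C k + Du k ** K k) *v x k + Dcl k *v w k"
      and zf: "zf = C N *v x N"
    \<comment> \<open>the storage function, which telescopes along the trajectory\<close>
    define s where "s k = x k \<bullet> (matrix_inv (P k) *v x k)" for k
    have step: "s (Suc k) - s k + vcat (w k) (z k) \<bullet> (Pi k *v vcat (w k) (z k))
        + \<epsilon> * (w k \<bullet> w k) \<le> 0" if "k < N" for k
      using e(2)[OF that, of "x k" "w k"] mult_right_mono[OF \<epsilon>_le[OF that], of "w k \<bullet> w k"] x z that
      by (simp add: Let_def s_def Acl_def Bcl_def Ccl_def)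
    have "s n + (\<Sum>k<n. vcat (w k) (z k) \<bullet> (Pi k *v vcat (w k) (z k)))
        + \<epsilon> * (\<Sum>k<n. w k \<bullet> w k) \<le> 0" if "n \<le> N" for n
      using that
    proof (induction n)
      case 0
      then show ?case by (simp add: s_def x0)
    next
      case (Suc n)
      then show ?case using step[of n] by (simp add: distrib_left)
    qed
    from this[of N] have "s N + (\<Sum>k<N. vcat (w k) (z k) \<bullet> (Pi k *v vcat (w k) (z k)))
        + \<epsilon> * (\<Sum>k<N. w k \<bullet> w k) \<le> 0" by simp
    moreover have "zf \<bullet> zf \<le> s N"
    proof (cases N)
      \<comment> \<open>over an empty horizon \<open>P N\<close> need not be invertible, but the final state is zero\<close>
      case 0
      then show ?thesis by (simp add: zf x0 s_def)
    next
      case (Suc k)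
      then show ?thesis
        using terminal_bound[OF P_Suc_pos terminal[unfolded Suc]] by (simp add: zf s_def)
    qed
    ultimately show "zf \<bullet> zf
        + (\<Sum>k<N. vcat (w k) (z k)
            \<bullet> (vcat (hcat (Qp k) (Sp k)) (hcat (transpose (Sp k)) (Rp k)) *v vcat (w k) (z k)))
        + \<epsilon> * (\<Sum>k<N. w k \<bullet> w k) \<le> 0"
      unfolding Pi_def by linarith
  qed
qed

end
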